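(* Let $0<q\le\infty$, $0<\alpha<\infty$, $w,v\in\mathcal{W}(0,\infty)$, and let $T$ be a monotone quasilinear operator on $\mathfrak{M}^+(0,\infty)$. Then the inequality $$\|Tf\|_{q,w,(0,\infty)}\le C\,\|f\|_{1,v,(0,\infty)},\qquad f\in\mathfrak{M}^{+,\uparrow}(0,\infty),$$ holds if and only if the inequality $$\left\|T\left(\frac{1}{V_*(x)^{\alpha+1}}\int_x^\infty h\,V_*^\alpha\right)\right\|_{q,w,(0,\infty)}\le C\,\|h\|_{1,(0,\infty)},\qquad h\in\mathfrak{M}^+(0,\infty),$$ holds, where $$V_*(x):=\int_x^\infty v(t)\,dt,\qquad x\in(0,\infty).$$
   Context: $\mathfrak{M}^+(0,\infty)$ is the set of measurable functions on $(0,\infty)$ that are non-negative on $(0,\infty)$; $\mathfrak{M}^{+,\uparrow}(0,\infty)$ is the subset of non-decreasing functions in $\mathfrak{M}^+(0,\infty)$; $\mathcal{W}(0,\infty)$ is the set of weights, i.e. measurable functions that are positive almost everywhere on $(0,\infty)$. For $\omega\in\mathfrak{M}^+(0,\infty)$: $\|f\|_{s,\omega,(0,\infty)}=\left(\int_0^\infty |f(x)|^s\omega(x)\,dx\right)^{1/s}$ if $s\in(0,\infty)$, and $\|f\|_{\infty,\omega,(0,\infty)}=\operatorname{ess\,sup}_{x\in(0,\infty)}|f(x)|\,\omega(x)$. When $\omega\equiv1$ one writes $\|f\|_{s,(0,\infty)}$. A monotone quasilinear operator on $\mathfrak{M}^+(0,\infty)$ is a map $T:\mathfrak{M}^+(0,\infty)\to\mathfrak{M}^+(0,\infty)$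 such that: (i) $T(\lambda f)=\lambda Tf$ for all $\lambda\ge0$ and $f\in\mathfrak{M}^+(0,\infty)$; (ii) there is a constant $c>0$, independent of $f,g$, such that $Tf(x)\le c\,Tg(x)$ for almost all $x$ whenever $f(x)\le g(x)$ for almost all $x$; (iii) there is a constant $c>0$, independent of $f,g$, such that $T(f+g)\le c\,(Tf+Tg)$ for all $f,g\in\mathfrak{M}^+(0,\infty)$. In the second inequality $T$ acts on the function $x\mapsto V_*(x)^{-\alpha-1}\int_x^\infty h(t)V_*(t)^\alpha\,dt$. An inequality "holds" if there is a constant $C>0$, independent of the function ($f$ or $h$), for which it is valid for all indicated functions; the constant $C$ may vary from one inequality to another. Conventions: $0\cdot\infty=0$, $\infty/\infty=0$, $0/0=0$. *)

theory Defs
  imports "HOL-Analysis.Analysis" "HOL-Probability.Essential_Supremum"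
begin

(* Non-negative functions on (0,\<infinity>) take values in [0,\<infinity>] and are modelled by total functions
   on the reals whose values outside (0,\<infinity>) are ignored. The arithmetic of ennreal satisfies
   0 * \<infinity> = 0, \<infinity> / \<infinity> = 0 and 0 / 0 = 0. *)

definition Mplus :: "(real \<Rightarrow> ennreal) set" where
  "Mplus = borel_measurable (lebesgue_on {0<..})"

definition Mplus_up :: "(real \<Rightarrow> ennreal) set" where
  "Mplus_up = {f \<in> Mplus. mono_on {0<..} f}"

definition weights :: "(real \<Rightarrow> ennreal) set" where
  "weights = {v \<in> Mplus. AE x in lebesgue_on {0<..}. 0 < v x}"

(* Intended for exponents a > 0, where \<infinity> to the power a is \<infinity>. *)
definition epowr :: "ennreal \<Rightarrow> real \<Rightarrow> ennreal" (infixr "epowr" 80) where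
  "x epowr a = (if x = \<infinity> then \<infinity> else ennreal (enn2real x powr a))"

definition wnorm :: "ennreal \<Rightarrow> (real \<Rightarrow> ennreal) \<Rightarrow> (real \<Rightarrow> ennreal) \<Rightarrow> ennreal" where
  "wnorm s \<omega> f =
    (if s = \<infinity> then esssup (lebesgue_on {0<..}) (\<lambda>x. f x * \<omega> x)
     else (\<integral>\<^sup>+x. (f x epowr enn2real s) * \<omega> x \<partial>lebesgue_on {0<..}) epowr (1 / enn2real s))"

(* The second clause says that T is an operation on functions on (0,\<infinity>): the values of f outside
   (0,\<infinity>) have no influence on T f on (0,\<infinity>). Relations between functions without an explicit
   quantifier over points (homogeneity, quasi-subadditivity) are understood almost everywhere. *)
definition monotone_quasilinear :: "((real \<Rightarrow> ennreal) \<Rightarrow> (real \<Rightarrow> ennreal)) \<Rightarrow> bool" where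
  "monotone_quasilinear T \<longleftrightarrow>
    (\<forall>f\<in>Mplus. T f \<in> Mplus) \<and>
    (\<forall>f\<in>Mplus. \<forall>g\<in>Mplus. (\<forall>x>0. f x = g x) \<longrightarrow> (\<forall>x>0. T f x = T g x)) \<and>
    (\<forall>r::real. \<forall>f\<in>Mplus. 0 \<le> r \<longrightarrow>
      (AE x in lebesgue_on {0<..}. T (\<lambda>y. ennreal r * f y) x = ennreal r * T f x)) \<and>
    (\<exists>c::real. c > 0 \<and> (\<forall>f\<in>Mplus. \<forall>g\<in>Mplus.
      (AE x in lebesgue_on {0<..}. f x \<le> g x) \<longrightarrow>
      (AE x in lebesgue_on {0<..}. T f x \<le> ennreal c * T g x))) \<and>
    (\<exists>c::real. c > 0 \<and> (\<forall>f\<in>Mplus. \<forall>g\<in>Mplus.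
      AE x in lebesgue_on {0<..}. T (\<lambda>y. f y + g y) x \<le> ennreal c * (T f x + T g x)))"

definition Vstar :: "(real \<Rightarrow> ennreal) \<Rightarrow> real \<Rightarrow> ennreal" where
  "Vstar v x = (\<integral>\<^sup>+t. v t \<partial>lebesgue_on {x<..})"

end

theory Submission
  imports Defs
begin

text \<open>
  Write \<open>V = Vstar v\<close> and let \<open>S h\<close> be the tail average
  \<open>S h x = V x powr (- \<alpha> - 1) * \<integral> h V powr \<alpha>\<close>, integrated over \<open>{x<..}\<close>. The operator \<open>T\<close> enters only through
  its homogeneity and its monotonicity up to a constant, so it suffices to compare the two classes of
  functions on which it acts: the non-decreasing functions with their norm in \<open>L\<^sup>1(v)\<close>, and the
  functions \<open>S h\<close> with the norm of \<open>h\<close> in \<open>L\<^sup>1\<close>. Each class is dominated by the other, with control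
  of these norms.

  Every \<open>S h\<close> lies below a non-decreasing function \<open>F\<close> with \<open>\<integral> F v \<le> (1 + 1 / \<alpha>) * \<integral> h\<close>. The kernel of
  \<open>S\<close> is \<open>V t powr \<alpha> / V x powr (\<alpha> + 1)\<close> for \<open>x < t\<close>; replacing \<open>V x\<close> by \<open>max (V x) (V t)\<close> extends it to all
  \<open>x, t > 0\<close> as a kernel that is non-decreasing in \<open>x\<close>, and \<open>F\<close> is the function obtained from \<open>h\<close> with it
  (\<open>tail_average_le_majorant\<close>, \<open>majorant_in_Mplus_up\<close>). Integrating the kernel against \<open>v x dx\<close> gives at
  most \<open>1 + 1 / \<alpha>\<close> for every \<open>t\<close> (\<open>tail_kernel_mass\<close>), and Tonelli's theorem does the rest
  (\<open>majorant_mass\<close>).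

  Conversely, a non-decreasing \<open>f\<close> with \<open>\<integral> f v < \<infinity>\<close> satisfies \<open>f \<le> 2 powr (\<alpha> + 1) * S (f v)\<close>
  (\<open>le_tail_average\<close>), and the norm of \<open>h = f v\<close> in \<open>L\<^sup>1\<close> is exactly the norm of \<open>f\<close> in \<open>L\<^sup>1(v)\<close>. If
  \<open>\<integral> f v = \<infinity>\<close>, there is nothing to prove.

  Both estimates would follow by substituting \<open>V\<close> for the variable if \<open>V\<close> were finite and smooth. It
  may be infinite on an initial interval, or everywhere, and jump from \<open>\<infinity>\<close> to a finite value. The
  substitution is therefore replaced by the inequality that the set where \<open>V \<le> s\<close> has mass at most \<open>s\<close>
  with respect to \<open>v dx\<close> (\<open>sublevel_mass\<close>), which holds in all these cases.
\<close>

section \<open>The measure space of the half-line\<close>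

abbreviation half_line :: "real measure" where
  "half_line \<equiv> lebesgue_on {0<..}"

lemma sigma_finite_half_line: "sigma_finite_measure half_line"
proof (rule sigma_finite_measure_restrict_space)
  show "sigma_finite_measure (lebesgue :: real measure)"
  proof
    show "\<exists>A::real set set. countable A \<and> A \<subseteq> sets lebesgue \<and> \<Union> A = space lebesgue
            \<and> (\<forall>a\<in>A. emeasure lebesgue a \<noteq> \<infinity>)"
    proof (intro exI[of _ "range (\<lambda>n::nat. {- real n..real n})"] conjI ballI)
      have "x \<in> (\<Union>n::nat. {- real n..real n})" for x
        using real_arch_simple[of "\<bar>x\<bar>"] by (simp add: abs_le_iff) (metis minus_le_iff)
      then show "(\<Union>n::nat. {- real n..real n}) = space lebesgue" by auto
    qed auto
  qed
qed simp

lemma ident_measurable_half_line [measurable]: "(\<lambda>x. x) \<in> borel_measurable half_line"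
  by (rule measurable_restrict_space1) (rule measurable_completion, simp)

lemma AE_half_line_neq: "AE t in half_line. t \<noteq> b"
proof -
  have "AE t in lebesgue. t \<noteq> b"
    by (intro AE_completion AE_lborel_singleton)
  then show ?thesis
    by (auto simp: AE_restrict_space_iff elim: eventually_mono)
qed

text \<open>
  All tail integrals are moved to the one measure space \<open>half_line\<close>, where Tonelli's theorem is
  available.
\<close>

lemma tail_integral:
  assumes "0 \<le> x"
  shows "(\<integral>\<^sup>+t. g t \<partial>lebesgue_on {x<..}) = (\<integral>\<^sup>+t. g t * indicator {x<..} t \<partial>half_line)"
  using assms by (auto simp: nn_integral_restrict_space intro!: nn_integral_cong split: split_indicator)

section \<open>Powers with values in [0, \<infinity>]\<close>

lemma epowr_measurable [measurable]: "(\<lambda>x. x epowr a) \<in> borel_measurable borel"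
  unfolding epowr_def by measurable

lemma epowr_mono: "0 \<le> a \<Longrightarrow> x \<le> y \<Longrightarrow> x epowr a \<le> y epowr a"
  by (cases x; cases y) (auto simp: epowr_def top_unique intro!: ennreal_leI powr_mono2)

lemma epowr_ennreal: "0 \<le> r \<Longrightarrow> ennreal r epowr a = ennreal (r powr a)"
  by (simp add: epowr_def)

lemma epowr_one [simp]: "x epowr 1 = x"
  by (cases x) (auto simp: epowr_def)

lemma epowr_cmult: "0 < r \<Longrightarrow> (ennreal r * x) epowr a = ennreal (r powr a) * x epowr a"
  by (cases x) (auto simp: epowr_def ennreal_mult_top ennreal_mult[symmetric] powr_mult)

lemma ennreal_inverse_antimono: "x \<le> y \<Longrightarrow> inverse y \<le> inverse (x :: ennreal)"
  by (cases x; cases y; cases "x = 0")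
    (auto simp: inverse_ennreal top_unique intro!: ennreal_leI le_imp_inverse_le)

section \<open>The weighted norm\<close>

lemma wnorm_1: "wnorm 1 v f = (\<integral>\<^sup>+x. f x * v x \<partial>half_line)"
  by (simp add: wnorm_def)

text \<open>
  This is what turns an almost everywhere estimate between values of \<open>T\<close> into an estimate between
  their norms. The factor passes through the power \<open>q\<close> and its inverse, or through the essential
  supremum, unchanged.
\<close>

lemma wnorm_le_cmult:
  assumes "0 < q" and w: "w \<in> Mplus" and g: "g \<in> Mplus" and g': "g' \<in> Mplus" and "0 < r"
    and le: "AE x in half_line. g x \<le> ennreal r * g' x"
  shows "wnorm q w g \<le> ennreal r * wnorm q w g'"
proof (cases "q = \<infinity>")
  case True
  have [measurable]: "w \<in> borel_measurable half_line" "g \<in> borel_measurable half_line"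
    using w g by (simp_all add: Mplus_def)
  have "AE x in half_line. g' x * w x \<le> esssup half_line (\<lambda>x. g' x * w x)"
    by (rule esssup_AE)
  with le have "AE x in half_line. g x * w x \<le> ennreal r * esssup half_line (\<lambda>x. g' x * w x)"
  proof eventually_elim
    case (elim x)
    have "g x * w x \<le> ennreal r * (g' x * w x)"
      using mult_right_mono[OF elim(1), of "w x"] by (simp add: mult.assoc)
    also have "\<dots> \<le> ennreal r * esssup half_line (\<lambda>x. g' x * w x)"
      by (intro mult_left_mono elim) auto
    finally show ?case .
  qed
  with True show ?thesis by (auto simp: wnorm_def intro!: esssup_I)
next
  case False
  have [measurable]: "w \<in> borel_measurable half_line" "g' \<in> borel_measurable half_line"
    using w g' by (simp_all add: Mplus_def)
  define p where "p = enn2real q"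
  have "0 < p"
    using \<open>0 < q\<close> False by (simp add: p_def enn2real_positive_iff top.not_eq_extremum)
  have "(\<integral>\<^sup>+x. g x epowr p * w x \<partial>half_line) \<le> (\<integral>\<^sup>+x. ennreal (r powr p) * (g' x epowr p * w x) \<partial>half_line)"
  proof (rule nn_integral_mono_AE)
    show "AE x in half_line. g x epowr p * w x \<le> ennreal (r powr p) * (g' x epowr p * w x)"
      using le
    proof eventually_elim
      case (elim x)
      have "g x epowr p \<le> ennreal (r powr p) * g' x epowr p"
        using epowr_mono[OF _ elim, of p] \<open>0 < p\<close> \<open>0 < r\<close> by (simp add: epowr_cmult)
      from mult_right_mono[OF this, of "w x"] show ?case by (simp add: mult.assoc)
    qed
  qed
  also have "\<dots> = ennreal (r powr p) * (\<integral>\<^sup>+x. g' x epowr p * w x \<partial>half_line)"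
    by (intro nn_integral_cmult) measurable
  finally have "wnorm q w g \<le> (ennreal (r powr p) * (\<integral>\<^sup>+x. g' x epowr p * w x \<partial>half_line)) epowr (1 / p)"
    using False \<open>0 < p\<close> by (auto simp: wnorm_def p_def[symmetric] intro!: epowr_mono)
  also have "\<dots> = ennreal r * wnorm q w g'"
    using False \<open>0 < p\<close> \<open>0 < r\<close> by (simp add: wnorm_def p_def[symmetric] epowr_cmult powr_powr)
  finally show ?thesis .
qed

section \<open>The tail of the weight\<close>

lemma Vstar_eq_half_line:
  "0 \<le> x \<Longrightarrow> Vstar v x = (\<integral>\<^sup>+t. v t * indicator {x<..} t \<partial>half_line)"
  unfolding Vstar_def by (rule tail_integral)

lemma Vstar_measurable [measurable]:
  assumes "v \<in> Mplus"
  shows "Vstar v \<in> borel_measurable half_line"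
proof -
  have [measurable]: "v \<in> borel_measurable half_line"
    using assms by (simp add: Mplus_def)
  interpret sigma_finite_measure half_line by (rule sigma_finite_half_line)
  have "(\<lambda>x. \<integral>\<^sup>+t. (if x < t then v t else 0) \<partial>half_line) \<in> borel_measurable half_line"
    by measurable
  moreover have "Vstar v x = (\<integral>\<^sup>+t. (if x < t then v t else 0) \<partial>half_line)" if "0 < x" for x
    using that by (auto simp: Vstar_eq_half_line intro!: nn_integral_cong split: split_indicator)
  ultimately show ?thesis
    by (subst measurable_cong[where g = "\<lambda>x. \<integral>\<^sup>+t. (if x < t then v t else 0) \<partial>half_line"]) auto
qed

lemma Vstar_antimono:
  assumes "0 \<le> x" "x \<le> y"
  shows "Vstar v y \<le> Vstar v x"
  using assms
  by (auto simp: Vstar_eq_half_line intro!: nn_integral_mono split: split_indicator)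

text \<open>
  Monotone convergence along \<open>b + 1 / (n + 1)\<close>. The point \<open>b\<close> may be \<open>0\<close>, and \<open>Vstar v b\<close> may be
  infinite, which is why the limit is stated through upper bounds.
\<close>

lemma Vstar_right_continuous:
  assumes v: "v \<in> Mplus" and "0 \<le> b" and le: "\<And>y. b < y \<Longrightarrow> Vstar v y \<le> s"
  shows "Vstar v b \<le> s"
proof -
  have [measurable]: "v \<in> borel_measurable half_line"
    using v by (simp add: Mplus_def)
  have sup: "v t * indicator {b<..} t = (SUP n::nat. v t * indicator {b + 1 / real (Suc n)<..} t)" for t
  proof (cases "b < t")
    case True
    then obtain n :: nat where "1 / real (Suc n) < t - b"
      using nat_approx_posE[of "t - b"] by auto
    then have "v t * indicator {b<..} t \<le> v t * indicator {b + 1 / real (Suc n)<..} t"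
      by (auto split: split_indicator)
    moreover have "v t * indicator {b + 1 / real (Suc n)<..} t \<le> v t * indicator {b<..} t" for n
      using True by (auto split: split_indicator)
    ultimately show ?thesis
      by (intro antisym SUP_upper2[of n] SUP_least) auto
  next
    case False
    have "t \<le> b + 1 / real (Suc n)" for n
      using False by (simp add: add_increasing2)
    then have "indicator {b + 1 / real (Suc n)<..} t = (0::ennreal)" for n
      by (simp add: not_less)
    with False show ?thesis by (simp del: of_nat_Suc)
  qed
  have "Vstar v b = (\<integral>\<^sup>+t. (SUP n::nat. v t * indicator {b + 1 / real (Suc n)<..} t) \<partial>half_line)"
    using \<open>0 \<le> b\<close> by (simp add: Vstar_eq_half_line sup[symmetric] del: of_nat_Suc)
  also have "\<dots> = (SUP n::nat. \<integral>\<^sup>+t. v t * indicator {b + 1 / real (Suc n)<..} t \<partial>half_line)"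
  proof (rule nn_integral_monotone_convergence_SUP)
    show "incseq (\<lambda>n t. v t * indicator {b + 1 / real (Suc n)<..} t)"
    proof (intro monoI le_funI mult_left_mono)
      fix m n :: nat and t :: real assume "m \<le> n"
      then have "1 / real (Suc n) \<le> 1 / real (Suc m)"
        by (simp add: frac_le)
      then show "indicator {b + 1 / real (Suc m)<..} t \<le> (indicator {b + 1 / real (Suc n)<..} t :: ennreal)"
        by (auto split: split_indicator)
    qed simp
  qed measurable
  also have "\<dots> = (SUP n::nat. Vstar v (b + 1 / real (Suc n)))"
    using \<open>0 \<le> b\<close> by (simp add: Vstar_eq_half_line)
  also have "\<dots> \<le> s"
    by (intro SUP_least le) simp
  finally show ?thesis .
qed

text \<open>
  The key fact about \<open>v\<close> and its tail, on which both directions rest: the image of the measure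
  \<open>v dx\<close> under \<open>Vstar v\<close> gives mass at most \<open>s\<close> to \<open>[0, s]\<close>. Since \<open>Vstar v\<close> is non-increasing, its
  sublevel set is, up to an end point, a half-line \<open>{b<..}\<close>; its mass is \<open>Vstar v b\<close>, and this is at most
  \<open>s\<close> by right continuity. The fact stands in for the substitution rule for \<open>d(Vstar v) = - v dx\<close>, and it
  holds also where the tail is infinite or jumps.
\<close>

lemma sublevel_mass:
  assumes v: "v \<in> Mplus"
  shows "(\<integral>\<^sup>+t. v t * indicator {t. Vstar v t \<le> s} t \<partial>half_line) \<le> s"
proof (cases "\<exists>t>0. Vstar v t \<le> s")
  case False
  then have "(\<integral>\<^sup>+t. v t * indicator {t. Vstar v t \<le> s} t \<partial>half_line) = (\<integral>\<^sup>+t. 0 \<partial>half_line)"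
    by (intro nn_integral_cong) auto
  then show ?thesis by simp
next
  case True
  define E where "E = {t. 0 < t \<and> Vstar v t \<le> s}"
  define b where "b = Inf E"
  have E: "E \<noteq> {}" "bdd_below E"
    using True by (auto simp: E_def intro!: bdd_belowI[of _ 0])
  have b0: "0 \<le> b"
    using E unfolding b_def by (intro cInf_greatest) (auto simp: E_def)
  have "Vstar v b \<le> s"
  proof (rule Vstar_right_continuous[OF v b0])
    fix y assume "b < y"
    then obtain e where "e \<in> E" "e < y"
      using E by (auto simp: b_def cInf_less_iff)
    then show "Vstar v y \<le> s"
      using Vstar_antimono[of e y v] by (auto simp: E_def)
  qed
  moreover have "(\<integral>\<^sup>+t. v t * indicator {t. Vstar v t \<le> s} t \<partial>half_line) \<le> Vstar v b"
  proof -
    have "AE t in half_line. t \<noteq> b \<and> t \<in> space half_line"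
      using AE_half_line_neq by auto
    then have "AE t in half_line. v t * indicator {t. Vstar v t \<le> s} t \<le> v t * indicator {b<..} t"
    proof eventually_elim
      case (elim t)
      then have "t \<in> E \<Longrightarrow> b < t"
        using cInf_lower[of t E] E by (auto simp: b_def)
      with elim show ?case by (auto simp: E_def split: split_indicator)
    qed
    then show ?thesis
      using b0 by (simp add: Vstar_eq_half_line nn_integral_mono_AE)
  qed
  ultimately show ?thesis by simp
qed

section \<open>Integrating the weight against powers of its tail\<close>

lemma nn_integral_powr_tail:
  assumes "0 < a" "0 < m"
  shows "(\<integral>\<^sup>+s. ennreal (s powr (- a - 1)) * indicator {m..} s \<partial>lborel) = ennreal (m powr (- a) / a)"
proof -
  have "(\<integral>\<^sup>+s. ennreal (s powr (- a - 1)) * indicator {m..} s \<partial>lborel) = 0 - (- (m powr (- a) / a))"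
  proof (rule nn_integral_FTC_atLeast)
    show "((\<lambda>s. - (s powr (- a) / a)) has_real_derivative s powr (- a - 1)) (at s)" if "m \<le> s" for s
      using that assms by (auto intro!: derivative_eq_intros)
    show "((\<lambda>s. - (s powr (- a) / a)) \<longlongrightarrow> 0) at_top"
      using tendsto_divide[OF tendsto_neg_powr[of "- a", OF _ filterlim_ident] tendsto_const[of a]] assms
      by (auto intro!: tendsto_minus_cancel[of _ 0])
  qed auto
  then show ?thesis by simp
qed

text \<open>
  With \<open>V = Vstar v\<close>, substituting \<open>V\<close> for the variable would give at most \<open>m powr (- \<alpha>) / \<alpha>\<close> for
  the part where \<open>V > m\<close>, and \<open>m * m powr (- \<alpha> - 1)\<close> for the part where \<open>V \<le> m\<close>. The proof is the
  layer cake formula: the power \<open>max V m powr (- \<alpha> - 1)\<close> is the integral of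
  \<open>(\<alpha> + 1) * s powr (- \<alpha> - 2)\<close> over \<open>s \<ge> max V m\<close>, and after Tonelli's theorem the inner integral is
  the mass of a sublevel set of \<open>V\<close>.
\<close>

lemma weight_against_truncated_tail:
  assumes v: "v \<in> Mplus" and "0 < \<alpha>" "0 < m"
  shows "(\<integral>\<^sup>+x. v x / (max (Vstar v x) (ennreal m) epowr (\<alpha> + 1)) \<partial>half_line)
    \<le> ennreal ((\<alpha> + 1) / \<alpha> * m powr (- \<alpha>))"
proof -
  have [measurable]: "v \<in> borel_measurable half_line" "Vstar v \<in> borel_measurable half_line"
    using v by (simp_all add: Mplus_def Vstar_measurable)
  interpret H: sigma_finite_measure half_line by (rule sigma_finite_half_line)
  interpret P: pair_sigma_finite lborel half_line ..
  define F where "F x s = (if m \<le> s \<and> Vstar v x \<le> ennreal s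
    then ennreal ((\<alpha> + 1) * s powr (- \<alpha> - 2)) * v x else 0)" for x s :: real
  have pointwise: "v x / (max (Vstar v x) (ennreal m) epowr (\<alpha> + 1)) = (\<integral>\<^sup>+s. F x s \<partial>lborel)"
    (is "?l = ?r") for x
  proof (cases "Vstar v x")
    case (real r)
    define M where "M = max r m"
    have M: "max (Vstar v x) (ennreal m) = ennreal M" "0 < M"
      using real \<open>0 < m\<close> by (auto simp: M_def max_def)
    have "?r = (\<integral>\<^sup>+s. (ennreal (\<alpha> + 1) * v x) * (ennreal (s powr (- (\<alpha> + 1) - 1)) * indicator {M..} s) \<partial>lborel)"
      using real \<open>0 < \<alpha>\<close> \<open>0 < m\<close>
      by (intro nn_integral_cong)
        (auto simp: F_def M_def ennreal_mult ac_simps split: split_indicator)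
    also have "\<dots> = ennreal (\<alpha> + 1) * v x * ennreal (M powr (- (\<alpha> + 1)) / (\<alpha> + 1))"
      using M \<open>0 < \<alpha>\<close> by (subst nn_integral_cmult) (simp_all only: nn_integral_powr_tail, auto)
    also have "\<dots> = v x * (ennreal (\<alpha> + 1) * ennreal (M powr (- (\<alpha> + 1)) / (\<alpha> + 1)))"
      by (simp add: ac_simps)
    also have "\<dots> = v x * ennreal (M powr (- (\<alpha> + 1)))"
      using \<open>0 < \<alpha>\<close> by (subst ennreal_mult[symmetric]) auto
    also have "\<dots> = ?l"
      using M by (simp add: epowr_ennreal divide_ennreal_def inverse_ennreal powr_minus[symmetric])
    finally show ?thesis by simp
  next
    case top
    then show ?thesis by (simp add: F_def epowr_def top_unique)
  qed
  have "(\<integral>\<^sup>+x. v x / (max (Vstar v x) (ennreal m) epowr (\<alpha> + 1)) \<partial>half_line)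
     = (\<integral>\<^sup>+x. \<integral>\<^sup>+s. F x s \<partial>lborel \<partial>half_line)"
    by (simp only: pointwise)
  also have "\<dots> = (\<integral>\<^sup>+s. \<integral>\<^sup>+x. F x s \<partial>half_line \<partial>lborel)"
    by (rule P.Fubini') (unfold F_def, measurable)
  also have "\<dots> = (\<integral>\<^sup>+s. ennreal ((\<alpha> + 1) * s powr (- \<alpha> - 2))
      * (\<integral>\<^sup>+x. v x * indicator {t. Vstar v t \<le> ennreal s} x \<partial>half_line) * indicator {m..} s \<partial>lborel)"
  proof (intro nn_integral_cong)
    fix s :: real
    have "(\<integral>\<^sup>+x. F x s \<partial>half_line) = (\<integral>\<^sup>+x. ennreal ((\<alpha> + 1) * s powr (- \<alpha> - 2)) * indicator {m..} s
        * (v x * indicator {t. Vstar v t \<le> ennreal s} x) \<partial>half_line)"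
      by (intro nn_integral_cong) (auto simp: F_def split: split_indicator)
    also have "\<dots> = ennreal ((\<alpha> + 1) * s powr (- \<alpha> - 2)) * indicator {m..} s
        * (\<integral>\<^sup>+x. v x * indicator {t. Vstar v t \<le> ennreal s} x \<partial>half_line)"
      by (intro nn_integral_cmult) measurable
    finally show "(\<integral>\<^sup>+x. F x s \<partial>half_line) = ennreal ((\<alpha> + 1) * s powr (- \<alpha> - 2))
        * (\<integral>\<^sup>+x. v x * indicator {t. Vstar v t \<le> ennreal s} x \<partial>half_line) * indicator {m..} s"
      by (simp only: ac_simps)
  qed
  also have "\<dots> \<le> (\<integral>\<^sup>+s. ennreal ((\<alpha> + 1) * s powr (- \<alpha> - 2)) * ennreal s * indicator {m..} s \<partial>lborel)"
    by (intro nn_integral_mono mult_right_mono mult_left_mono sublevel_mass v) auto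
  also have "\<dots> = (\<integral>\<^sup>+s. ennreal (\<alpha> + 1) * (ennreal (s powr (- \<alpha> - 1)) * indicator {m..} s) \<partial>lborel)"
  proof (intro nn_integral_cong)
    fix s :: real
    have "s powr (- \<alpha> - 2) * s = s powr (- \<alpha> - 1)" if "m \<le> s"
    proof -
      have "- \<alpha> - 1 = (- \<alpha> - 2) + 1" by simp
      then show ?thesis
        using that \<open>0 < m\<close> by (simp only: powr_add) simp
    qed
    then show "ennreal ((\<alpha> + 1) * s powr (- \<alpha> - 2)) * ennreal s * indicator {m..} s
        = ennreal (\<alpha> + 1) * (ennreal (s powr (- \<alpha> - 1)) * indicator {m..} s)"
      using \<open>0 < \<alpha>\<close> \<open>0 < m\<close>
      by (auto simp: ennreal_mult[symmetric] mult.assoc simp del: ennreal_plus split: split_indicator)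
  qed
  also have "\<dots> = ennreal (\<alpha> + 1) * ennreal (m powr (- \<alpha>) / \<alpha>)"
    using assms by (subst nn_integral_cmult) (simp_all only: nn_integral_powr_tail, auto)
  also have "\<dots> = ennreal ((\<alpha> + 1) / \<alpha> * m powr (- \<alpha>))"
    using assms by (simp add: ennreal_mult[symmetric] del: ennreal_plus)
  finally show ?thesis .
qed

section \<open>A non-decreasing majorant of the tail average\<close>

text \<open>
  Let \<open>V = Vstar v\<close>. Where \<open>V\<close> is positive and finite, this is the kernel
  \<open>V t powr \<alpha> / V x powr (\<alpha> + 1)\<close> of the tail average for \<open>x < t\<close>, continued to \<open>t \<le> x\<close> by its value
  \<open>1 / V t\<close> on the diagonal; the continuation makes it non-decreasing in \<open>x\<close> throughout. Where \<open>V x\<close> or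
  \<open>V t\<close> is infinite, the quotient is \<open>0\<close>, as is the coefficient \<open>1 / \<infinity>\<close> in the tail average.
\<close>

definition tail_kernel :: "(real \<Rightarrow> ennreal) \<Rightarrow> real \<Rightarrow> real \<Rightarrow> real \<Rightarrow> ennreal" where
  "tail_kernel v \<alpha> x t = Vstar v t epowr \<alpha> / (max (Vstar v x) (Vstar v t) epowr (\<alpha> + 1))"

definition majorant :: "(real \<Rightarrow> ennreal) \<Rightarrow> real \<Rightarrow> (real \<Rightarrow> ennreal) \<Rightarrow> real \<Rightarrow> ennreal" where
  "majorant v \<alpha> h x = (\<integral>\<^sup>+t. h t * tail_kernel v \<alpha> x t \<partial>half_line)"

definition tail_average :: "(real \<Rightarrow> ennreal) \<Rightarrow> real \<Rightarrow> (real \<Rightarrow> ennreal) \<Rightarrow> real \<Rightarrow> ennreal" where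
  "tail_average v \<alpha> h x = 1 / (Vstar v x epowr (\<alpha> + 1))
     * (\<integral>\<^sup>+t. h t * (Vstar v t epowr \<alpha>) \<partial>lebesgue_on {x<..})"

text \<open>
  The bound does not depend on \<open>t\<close>: the truncated power of the tail contributes
  \<open>Vstar v t powr (- \<alpha>)\<close>, and the numerator cancels it.
\<close>

lemma tail_kernel_mass:
  assumes v: "v \<in> Mplus" and "0 < \<alpha>"
  shows "(\<integral>\<^sup>+x. tail_kernel v \<alpha> x t * v x \<partial>half_line) \<le> ennreal ((\<alpha> + 1) / \<alpha>)"
proof (cases "Vstar v t")
  case top
  then show ?thesis by (simp add: tail_kernel_def epowr_def)
next
  case (real m)
  have [measurable]: "v \<in> borel_measurable half_line" "Vstar v \<in> borel_measurable half_line"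
    using v by (simp_all add: Mplus_def Vstar_measurable)
  show ?thesis
  proof (cases "m = 0")
    case True
    with real show ?thesis by (simp add: tail_kernel_def epowr_def)
  next
    case False
    with real have "0 < m" by simp
    have "(\<integral>\<^sup>+x. tail_kernel v \<alpha> x t * v x \<partial>half_line)
       = ennreal (m powr \<alpha>) * (\<integral>\<^sup>+x. v x / (max (Vstar v x) (ennreal m) epowr (\<alpha> + 1)) \<partial>half_line)"
      using real by (subst nn_integral_cmult[symmetric])
        (auto simp: tail_kernel_def epowr_ennreal divide_ennreal_def ac_simps)
    also have "\<dots> \<le> ennreal (m powr \<alpha>) * ennreal ((\<alpha> + 1) / \<alpha> * m powr (- \<alpha>))"
      by (intro mult_left_mono weight_against_truncated_tail v \<open>0 < \<alpha>\<close> \<open>0 < m\<close>) auto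
    also have "\<dots> = ennreal ((\<alpha> + 1) / \<alpha>)"
      using \<open>0 < m\<close> \<open>0 < \<alpha>\<close> by (simp add: ennreal_mult[symmetric] powr_minus)
    finally show ?thesis .
  qed
qed

lemma tail_kernel_measurable:
  assumes "v \<in> Mplus"
  shows "(\<lambda>(x, t). tail_kernel v \<alpha> x t) \<in> borel_measurable (half_line \<Otimes>\<^sub>M half_line)"
proof -
  have [measurable]: "Vstar v \<in> borel_measurable half_line"
    using assms by (rule Vstar_measurable)
  show ?thesis unfolding tail_kernel_def by measurable
qed

lemma majorant_in_Mplus_up:
  assumes v: "v \<in> Mplus" and h: "h \<in> Mplus" and "0 < \<alpha>"
  shows "majorant v \<alpha> h \<in> Mplus_up"
proof -
  have [measurable]: "h \<in> borel_measurable half_line"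
    using h by (simp add: Mplus_def)
  note tail_kernel_measurable[OF v, measurable]
  interpret sigma_finite_measure half_line by (rule sigma_finite_half_line)
  have "majorant v \<alpha> h \<in> borel_measurable half_line"
    unfolding majorant_def[abs_def] by measurable
  moreover have "mono_on {0<..} (majorant v \<alpha> h)"
  proof (rule mono_onI)
    fix x y :: real assume "x \<in> {0<..}" "x \<le> y"
    then have "max (Vstar v y) (Vstar v t) \<le> max (Vstar v x) (Vstar v t)" for t
      using Vstar_antimono[of x y v] by (auto simp: max.coboundedI1)
    then show "majorant v \<alpha> h x \<le> majorant v \<alpha> h y"
      using \<open>0 < \<alpha>\<close> unfolding majorant_def tail_kernel_def divide_ennreal_def
      by (intro nn_integral_mono mult_left_mono ennreal_inverse_antimono epowr_mono) auto
  qed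
  ultimately show ?thesis by (simp add: Mplus_up_def Mplus_def)
qed

text \<open>
  Tonelli's theorem reduces the claim to the mass of the kernel in its first variable.
\<close>

lemma majorant_mass:
  assumes v: "v \<in> Mplus" and h: "h \<in> Mplus" and "0 < \<alpha>"
  shows "(\<integral>\<^sup>+x. majorant v \<alpha> h x * v x \<partial>half_line)
    \<le> ennreal ((\<alpha> + 1) / \<alpha>) * (\<integral>\<^sup>+t. h t \<partial>half_line)"
proof -
  have [measurable]: "h \<in> borel_measurable half_line" "v \<in> borel_measurable half_line"
    using h v by (simp_all add: Mplus_def)
  note tail_kernel_measurable[OF v, measurable]
  interpret H: sigma_finite_measure half_line by (rule sigma_finite_half_line)
  interpret P: pair_sigma_finite half_line half_line ..
  have "(\<integral>\<^sup>+x. majorant v \<alpha> h x * v x \<partial>half_line)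
     = (\<integral>\<^sup>+x. \<integral>\<^sup>+t. h t * (tail_kernel v \<alpha> x t * v x) \<partial>half_line \<partial>half_line)"
    unfolding majorant_def
    by (intro nn_integral_cong, subst nn_integral_multc[symmetric]) (auto simp: ac_simps)
  also have "\<dots> = (\<integral>\<^sup>+t. \<integral>\<^sup>+x. h t * (tail_kernel v \<alpha> x t * v x) \<partial>half_line \<partial>half_line)"
    by (rule P.Fubini'[symmetric]) measurable
  also have "\<dots> = (\<integral>\<^sup>+t. h t * (\<integral>\<^sup>+x. tail_kernel v \<alpha> x t * v x \<partial>half_line) \<partial>half_line)"
    by (intro nn_integral_cong nn_integral_cmult) measurable
  also have "\<dots> \<le> (\<integral>\<^sup>+t. h t * ennreal ((\<alpha> + 1) / \<alpha>) \<partial>half_line)"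
    by (intro nn_integral_mono mult_left_mono tail_kernel_mass v \<open>0 < \<alpha>\<close>) auto
  also have "\<dots> = ennreal ((\<alpha> + 1) / \<alpha>) * (\<integral>\<^sup>+t. h t \<partial>half_line)"
    by (subst nn_integral_multc) (auto simp: ac_simps)
  finally show ?thesis .
qed

lemma tail_average_eq:
  assumes v: "v \<in> Mplus" and h: "h \<in> Mplus" and "0 < x"
  shows "tail_average v \<alpha> h x
    = (\<integral>\<^sup>+t. h t * (Vstar v t epowr \<alpha> / (Vstar v x epowr (\<alpha> + 1))) * indicator {x<..} t \<partial>half_line)"
proof -
  have [measurable]: "h \<in> borel_measurable half_line" "Vstar v \<in> borel_measurable half_line"
    using h v by (simp_all add: Mplus_def Vstar_measurable)
  have "tail_average v \<alpha> h x = 1 / (Vstar v x epowr (\<alpha> + 1))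
     * (\<integral>\<^sup>+t. h t * (Vstar v t epowr \<alpha>) * indicator {x<..} t \<partial>half_line)"
    unfolding tail_average_def using \<open>0 < x\<close> by (subst tail_integral) auto
  also have "\<dots> = (\<integral>\<^sup>+t. 1 / (Vstar v x epowr (\<alpha> + 1)) * (h t * (Vstar v t epowr \<alpha>) * indicator {x<..} t) \<partial>half_line)"
    by (intro nn_integral_cmult[symmetric]) measurable
  also have "\<dots> = (\<integral>\<^sup>+t. h t * (Vstar v t epowr \<alpha> / (Vstar v x epowr (\<alpha> + 1))) * indicator {x<..} t \<partial>half_line)"
    by (intro nn_integral_cong) (simp add: divide_ennreal_def ac_simps)
  finally show ?thesis .
qed

text \<open>
  Above the diagonal the two kernels agree, because there \<open>max (Vstar v x) (Vstar v t) = Vstar v x\<close>.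
\<close>

lemma tail_average_le_majorant:
  assumes v: "v \<in> Mplus" and h: "h \<in> Mplus" and "0 < x"
  shows "tail_average v \<alpha> h x \<le> majorant v \<alpha> h x"
  unfolding tail_average_eq[OF assms] majorant_def
  using Vstar_antimono[of x _ v] \<open>0 < x\<close>
  by (intro nn_integral_mono) (auto simp: tail_kernel_def max_absorb1 split: split_indicator)

lemma tail_average_in_Mplus:
  assumes v: "v \<in> Mplus" and h: "h \<in> Mplus"
  shows "tail_average v \<alpha> h \<in> Mplus"
proof -
  have [measurable]: "h \<in> borel_measurable half_line" "Vstar v \<in> borel_measurable half_line"
    using h v by (simp_all add: Mplus_def Vstar_measurable)
  interpret sigma_finite_measure half_line by (rule sigma_finite_half_line)
  let ?g = "\<lambda>x. \<integral>\<^sup>+t. (if x < t then h t * (Vstar v t epowr \<alpha> / (Vstar v x epowr (\<alpha> + 1))) else 0) \<partial>half_line"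
  have "?g \<in> borel_measurable half_line"
    by measurable
  moreover have "tail_average v \<alpha> h x = ?g x" if "0 < x" for x
    unfolding tail_average_eq[OF v h that]
    by (auto intro!: nn_integral_cong split: split_indicator)
  ultimately show ?thesis
    unfolding Mplus_def by (subst measurable_cong[where g = ?g]) auto
qed

section \<open>Non-decreasing functions are bounded by tail averages\<close>

text \<open>
  A tail that vanishes forces \<open>v = 0\<close> almost everywhere on a half-line, against positivity of the
  weight.
\<close>

lemma weight_tail_pos:
  assumes v: "v \<in> weights" and "0 < x"
  shows "0 < Vstar v x"
proof (rule ccontr)
  have [measurable]: "v \<in> borel_measurable half_line"
    using v by (simp add: weights_def Mplus_def)
  have [measurable]: "{x<..} \<in> sets half_line"
    using \<open>0 < x\<close> by (auto simp: sets_restrict_space_iff)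
  assume "\<not> 0 < Vstar v x"
  then have "(\<integral>\<^sup>+t. v t * indicator {x<..} t \<partial>half_line) = 0"
    using \<open>0 < x\<close> by (simp add: Vstar_eq_half_line)
  then have "AE t in half_line. v t * indicator {x<..} t = 0"
    by (subst (asm) nn_integral_0_iff_AE) auto
  moreover have "AE t in half_line. 0 < v t"
    using v by (simp add: weights_def)
  ultimately have "AE t in half_line. t \<notin> {x<..}"
    by eventually_elim auto
  then have "emeasure half_line {x<..} = 0"
    by (subst (asm) AE_iff_measurable[where N = "{x<..}"]) (use \<open>0 < x\<close> in auto)
  then have "emeasure lebesgue {x<..} = 0"
    using \<open>0 < x\<close> by (subst (asm) emeasure_restrict_space) auto
  (* With its end point the half-line contains an interval of length 1. *)
  moreover have "emeasure lebesgue {x..x + 1} \<le> emeasure lebesgue ({x<..} \<union> {x})"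
    by (intro emeasure_mono) auto
  moreover have "emeasure lebesgue ({x<..} \<union> {x}) \<le> emeasure lebesgue {x<..} + emeasure lebesgue {x}"
    by (intro emeasure_subadditive) auto
  ultimately show False by simp
qed

text \<open>
  With \<open>V = Vstar v\<close>, monotonicity of \<open>f\<close> gives \<open>\<integral> f v V powr \<alpha> \<ge> f x * \<integral> v V powr \<alpha>\<close> over \<open>{x<..}\<close>, so \<open>\<integral> v V powr \<alpha>\<close>
  has to be at least a multiple of \<open>V x powr (\<alpha> + 1)\<close>. The points with \<open>V t \<le> V x / 2\<close> carry at most half
  of the mass \<open>V x\<close>; on the remaining ones, which carry at least \<open>V x / 2\<close>, the factor \<open>V t powr \<alpha>\<close> is at
  least \<open>(V x / 2) powr \<alpha>\<close>. Finiteness of \<open>\<integral> f v\<close> is needed where \<open>V x = \<infinity>\<close>: there the tail average is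
  \<open>0\<close>, and so is \<open>f x\<close>, because \<open>f x * V x \<le> \<integral> f v\<close>.
\<close>

lemma le_tail_average:
  assumes v: "v \<in> weights" and f: "f \<in> Mplus_up" and "0 < \<alpha>"
    and fin: "(\<integral>\<^sup>+x. f x * v x \<partial>half_line) < \<infinity>" and "0 < x"
  shows "f x \<le> ennreal (2 powr (\<alpha> + 1)) * tail_average v \<alpha> (\<lambda>t. f t * v t) x"
proof -
  have [measurable]: "v \<in> borel_measurable half_line" "f \<in> borel_measurable half_line"
    using v f by (simp_all add: weights_def Mplus_def Mplus_up_def)
  have vM: "v \<in> Mplus" using v by (simp add: weights_def)
  have [measurable]: "Vstar v \<in> borel_measurable half_line"
    using vM by (rule Vstar_measurable)
  have [measurable]: "{x<..} \<in> sets half_line"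
    using \<open>0 < x\<close> by (auto simp: sets_restrict_space_iff)
  have mono: "f x \<le> f t" if "x < t" for t
    using f that \<open>0 < x\<close> by (auto simp: Mplus_up_def intro: mono_onD)
  have "f x * Vstar v x = (\<integral>\<^sup>+t. f x * (v t * indicator {x<..} t) \<partial>half_line)"
    using \<open>0 < x\<close> by (simp add: Vstar_eq_half_line nn_integral_cmult)
  also have "\<dots> \<le> (\<integral>\<^sup>+t. f t * v t \<partial>half_line)"
    by (intro nn_integral_mono) (auto intro!: mult_right_mono mono split: split_indicator)
  finally have fV: "f x * Vstar v x < \<infinity>" using fin by simp
  show ?thesis
  proof (cases "Vstar v x")
    case top
    with fV show ?thesis by (cases "f x = 0") (auto simp: ennreal_mult_top)
  next
    case (real V)
    then have "0 < V" using weight_tail_pos[OF v \<open>0 < x\<close>] by simp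
    define A where "A = (\<integral>\<^sup>+t. v t * indicator {t. x < t \<and> ennreal (V / 2) < Vstar v t} t \<partial>half_line)"
    have "ennreal V = (\<integral>\<^sup>+t. v t * indicator {x<..} t \<partial>half_line)"
      using real \<open>0 < x\<close> by (simp add: Vstar_eq_half_line)
    also have "\<dots> \<le> (\<integral>\<^sup>+t. v t * indicator {t. x < t \<and> ennreal (V / 2) < Vstar v t} t
        + v t * indicator {t. Vstar v t \<le> ennreal (V / 2)} t \<partial>half_line)"
      by (intro nn_integral_mono) (auto split: split_indicator)
    also have "\<dots> = A + (\<integral>\<^sup>+t. v t * indicator {t. Vstar v t \<le> ennreal (V / 2)} t \<partial>half_line)"
      unfolding A_def by (intro nn_integral_add) measurable
    also have "\<dots> \<le> A + ennreal (V / 2)"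
      by (intro add_left_mono sublevel_mass vM)
    finally have A: "ennreal (V / 2) \<le> A"
      using \<open>0 < V\<close> by (cases A) (auto simp: ennreal_plus[symmetric] ennreal_le_iff simp del: ennreal_plus)
    (* One factor V / 2 is at most the mass A; the power of V / 2 that is left is at most
       the power of the tail on the set that carries this mass. *)
    have "f x * ennreal ((V / 2) powr (\<alpha> + 1)) = f x * ennreal ((V / 2) powr \<alpha>) * ennreal (V / 2)"
      using \<open>0 < V\<close> by (simp add: powr_add ennreal_mult mult.assoc del: times_divide_eq_right)
    also have "\<dots> \<le> f x * ennreal ((V / 2) powr \<alpha>) * A"
      by (intro mult_left_mono A) auto
    also have "\<dots> = (\<integral>\<^sup>+t. f x * ennreal ((V / 2) powr \<alpha>)
        * (v t * indicator {t. x < t \<and> ennreal (V / 2) < Vstar v t} t) \<partial>half_line)"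
      unfolding A_def by (intro nn_integral_cmult[symmetric]) measurable
    also have "\<dots> \<le> (\<integral>\<^sup>+t. f t * v t * (Vstar v t epowr \<alpha>) * indicator {x<..} t \<partial>half_line)"
    proof (intro nn_integral_mono)
      fix t
      have "f x * ennreal ((V / 2) powr \<alpha>) * v t \<le> f t * (Vstar v t epowr \<alpha>) * v t"
        if "x < t" "ennreal (V / 2) < Vstar v t"
        using that \<open>0 < V\<close> \<open>0 < \<alpha>\<close> epowr_mono[of \<alpha> "ennreal (V / 2)" "Vstar v t"]
        by (intro mult_mono mono) (auto simp: epowr_ennreal)
      then show "f x * ennreal ((V / 2) powr \<alpha>) * (v t * indicator {t. x < t \<and> ennreal (V / 2) < Vstar v t} t)
          \<le> f t * v t * (Vstar v t epowr \<alpha>) * indicator {x<..} t"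
        by (auto simp: ac_simps split: split_indicator)
    qed
    also have "\<dots> = (\<integral>\<^sup>+t. f t * v t * (Vstar v t epowr \<alpha>) \<partial>lebesgue_on {x<..})"
      using \<open>0 < x\<close> by (intro tail_integral[symmetric]) simp
    finally have *: "f x * ennreal ((V / 2) powr (\<alpha> + 1)) \<le> \<dots>" .
    have "ennreal (2 powr (\<alpha> + 1)) * (1 / (Vstar v x epowr (\<alpha> + 1)) * ennreal ((V / 2) powr (\<alpha> + 1))) = 1"
      using real \<open>0 < V\<close>
      by (simp add: epowr_ennreal divide_ennreal_def inverse_ennreal ennreal_mult[symmetric] powr_divide)
    then have "f x = ennreal (2 powr (\<alpha> + 1)) * (1 / (Vstar v x epowr (\<alpha> + 1))
        * (f x * ennreal ((V / 2) powr (\<alpha> + 1))))"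
      by (metis (no_types, lifting) mult.assoc mult.left_commute mult.right_neutral)
    also have "\<dots> \<le> ennreal (2 powr (\<alpha> + 1)) * tail_average v \<alpha> (\<lambda>t. f t * v t) x"
      unfolding tail_average_def by (intro mult_left_mono *) auto
    finally show ?thesis .
  qed
qed

section \<open>The equivalence of the two inequalities\<close>

theorem theorem2p2:
  fixes q :: ennreal and \<alpha> :: real
    and w v :: "real \<Rightarrow> ennreal"
    and T :: "(real \<Rightarrow> ennreal) \<Rightarrow> (real \<Rightarrow> ennreal)"
  assumes "0 < q" and "0 < \<alpha>"
    and "w \<in> weights" and "v \<in> weights"
    and "monotone_quasilinear T"
  shows "(\<exists>C::real. C > 0 \<and>
            (\<forall>f\<in>Mplus_up. wnorm q w (T f) \<le> ennreal C * wnorm 1 v f))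
     \<longleftrightarrow>
         (\<exists>C::real. C > 0 \<and>
            (\<forall>h\<in>Mplus.
               wnorm q w
                 (T (\<lambda>x. 1 / (Vstar v x epowr (\<alpha> + 1))
                          * (\<integral>\<^sup>+t. h t * (Vstar v t epowr \<alpha>) \<partial>lebesgue_on {x<..})))
               \<le> ennreal C * wnorm 1 (\<lambda>_. 1) h))"
proof -
  have v: "v \<in> Mplus" and w: "w \<in> Mplus"
    using assms by (simp_all add: weights_def)
  note quasilinear = assms(5)[unfolded monotone_quasilinear_def]
  have T_in: "T f \<in> Mplus" if "f \<in> Mplus" for f
    using quasilinear[THEN conjunct1] that by blast
  have T_hom: "AE x in half_line. T (\<lambda>y. ennreal r * f y) x = ennreal r * T f x"
    if "f \<in> Mplus" "0 \<le> r" for r f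
    using quasilinear[THEN conjunct2, THEN conjunct2, THEN conjunct1] that by blast
  obtain c :: real where "0 < c" and
    T_mono: "\<And>f g. f \<in> Mplus \<Longrightarrow> g \<in> Mplus \<Longrightarrow> AE x in half_line. f x \<le> g x
       \<Longrightarrow> AE x in half_line. T f x \<le> ennreal c * T g x"
    using quasilinear[THEN conjunct2, THEN conjunct2, THEN conjunct2, THEN conjunct1] by blast
  let ?up = "\<lambda>C. \<forall>f\<in>Mplus_up. wnorm q w (T f) \<le> ennreal C * wnorm 1 v f"
  let ?av = "\<lambda>C. \<forall>h\<in>Mplus. wnorm q w (T (tail_average v \<alpha> h)) \<le> ennreal C * wnorm 1 (\<lambda>_. 1) h"
  have "?av (c * C * ((\<alpha> + 1) / \<alpha>))" if "0 < C" and up: "?up C" for C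
  proof
    fix h assume h: "h \<in> Mplus"
    let ?F = "majorant v \<alpha> h"
    have F: "?F \<in> Mplus_up" "?F \<in> Mplus"
      using majorant_in_Mplus_up[OF v h \<open>0 < \<alpha>\<close>] by (simp_all add: Mplus_up_def)
    have "AE x in half_line. T (tail_average v \<alpha> h) x \<le> ennreal c * T ?F x"
      using tail_average_le_majorant[OF v h]
      by (intro T_mono tail_average_in_Mplus v h F AE_I2) auto
    then have "wnorm q w (T (tail_average v \<alpha> h)) \<le> ennreal c * wnorm q w (T ?F)"
      by (intro wnorm_le_cmult \<open>0 < q\<close> w T_in tail_average_in_Mplus v h F \<open>0 < c\<close>)
    also have "\<dots> \<le> ennreal c * (ennreal C * wnorm 1 v ?F)"
      using up F by (intro mult_left_mono) auto
    also have "\<dots> \<le> ennreal c * (ennreal C * (ennreal ((\<alpha> + 1) / \<alpha>) * wnorm 1 (\<lambda>_. 1) h))"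
      using majorant_mass[OF v h \<open>0 < \<alpha>\<close>] by (intro mult_left_mono) (auto simp: wnorm_1)
    also have "\<dots> = ennreal (c * C * ((\<alpha> + 1) / \<alpha>)) * wnorm 1 (\<lambda>_. 1) h"
      using \<open>0 < c\<close> \<open>0 < C\<close> \<open>0 < \<alpha>\<close> by (simp add: ennreal_mult mult.assoc del: times_divide_eq_right)
    finally show "wnorm q w (T (tail_average v \<alpha> h)) \<le> \<dots>" .
  qed
  moreover have "0 < c * C * ((\<alpha> + 1) / \<alpha>)" if "0 < C" for C
    using that \<open>0 < c\<close> \<open>0 < \<alpha>\<close> by simp
  moreover have "?up (c * 2 powr (\<alpha> + 1) * C)" if "0 < C" and av: "?av C" for C
  proof
    fix f assume f: "f \<in> Mplus_up"
    then have fM: "f \<in> Mplus" by (simp add: Mplus_up_def)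
    let ?K = "2 powr (\<alpha> + 1) :: real"
    show "wnorm q w (T f) \<le> ennreal (c * ?K * C) * wnorm 1 v f"
    (* An infinite right-hand side makes the inequality trivial, so f may be taken integrable against v. *)
    proof (cases "wnorm 1 v f = \<infinity>")
      case True
      with \<open>0 < c\<close> \<open>0 < C\<close> show ?thesis by (simp add: ennreal_mult_top)
    next
      case False
      let ?h = "\<lambda>t. f t * v t"
      have h: "?h \<in> Mplus"
        using fM v unfolding Mplus_def by measurable
      have S: "tail_average v \<alpha> ?h \<in> Mplus"
        by (rule tail_average_in_Mplus[OF v h])
      have KS: "(\<lambda>x. ennreal ?K * tail_average v \<alpha> ?h x) \<in> Mplus"
        using S unfolding Mplus_def by measurable
      have "AE x in half_line. f x \<le> ennreal ?K * tail_average v \<alpha> ?h x"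
        using False le_tail_average[OF \<open>v \<in> weights\<close> f \<open>0 < \<alpha>\<close>]
        by (intro AE_I2) (auto simp: wnorm_1 top.not_eq_extremum)
      from T_mono[OF fM KS this] T_hom[OF S, of ?K]
      have "AE x in half_line. T f x \<le> ennreal (c * ?K) * T (tail_average v \<alpha> ?h) x"
        using \<open>0 < c\<close> by (auto simp: ennreal_mult mult.assoc)
      then have "wnorm q w (T f) \<le> ennreal (c * ?K) * wnorm q w (T (tail_average v \<alpha> ?h))"
        using \<open>0 < c\<close> by (intro wnorm_le_cmult \<open>0 < q\<close> w T_in fM S) auto
      also have "\<dots> \<le> ennreal (c * ?K) * (ennreal C * wnorm 1 (\<lambda>_. 1) ?h)"
        using av h by (intro mult_left_mono) auto
      also have "\<dots> = ennreal (c * ?K * C) * wnorm 1 v f"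
        using \<open>0 < c\<close> \<open>0 < C\<close> by (simp add: ennreal_mult mult.assoc wnorm_1)
      finally show ?thesis .
    qed
  qed
  moreover have "0 < c * 2 powr (\<alpha> + 1) * C" if "0 < C" for C
    using that \<open>0 < c\<close> by simp
  moreover have tail_average: "(\<lambda>x. 1 / (Vstar v x epowr (\<alpha> + 1))
      * (\<integral>\<^sup>+t. h t * (Vstar v t epowr \<alpha>) \<partial>lebesgue_on {x<..})) = tail_average v \<alpha> h" for h
    by (simp add: fun_eq_iff tail_average_def)
  ultimately show ?thesis
    unfolding tail_average by meson
qed

end
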